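(* Let $L=K_1\cup\cdots\cup K_\ell\subset S^3$ be a link with integral framing $\Lambda$, and let $\mathcal{C}_\Lambda(L)$ be its link surgery complex. For $\gamma\in H_1(S^3_\Lambda(L))/\mathrm{Tors}$, choose integers $a_1,\dots,a_\ell$ with $\gamma=a_1\mu_1+\cdots+a_\ell\mu_\ell$, and define $\mathfrak{A}_\gamma=a_1F^{K_1}+\cdots+a_\ell F^{K_\ell}$, where $F^{K_i}=\sum_{\vec M\ni +K_i}\Phi^{\vec M}$ is the sum of all hypercube structure maps of $\mathcal{C}_\Lambda(L)$ for oriented sublinks $\vec M\subseteq L$ containing $K_i$ with its positive orientation. Then the endomorphism $\mathfrak{A}_\gamma$ of $\mathcal{C}_\Lambda(L)$ is well-defined up to $\mathbb{F}[[U_1,\dots,U_\ell]]$-equivariant chain homotopy (i.e. up to such homotopy it depends only on the class $\gamma\in H_1(S^3_\Lambda(L))/\mathrm{Tors}$, not on the chosen expression of $\gamma$ in terms of the meridians).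
   Context: $\mathbb{F}=\mathbb{Z}/2$. $\Lambda$ also denotes the symmetric $\ell\times\ell$ matrix with the framings on the diagonal and $\Lambda_{i,j}=\mathrm{lk}(K_i,K_j)$ for $i\neq j$; then $H_1(S^3_\Lambda(L))\cong\mathbb{Z}^\ell/\operatorname{im}\Lambda$, where $\mathbb{Z}^\ell$ is free on the meridians $\mu_1,\dots,\mu_\ell$ of the components. $\mathcal{C}_\Lambda(L)$ is Manolescu and Ozsváth's link surgery complex, in the following form. The link Floer complex $\mathcal{CFL}(L)$ is the free $\mathbb{F}[\mathscr{U}_1,\mathscr{V}_1,\dots,\mathscr{U}_\ell,\mathscr{V}_\ell]$-module generated by intersection points of the Lagrangian tori of a Heegaard link diagram, whose differential counts index 1 holomorphic disks weighted by $\prod_i\mathscr{U}_i^{n_{w_i}}\mathscr{V}_i^{n_{z_i}}$. It has an Alexander multigrading $A=(A_1,\dots,A_\ell)$ with values in $\mathbb{H}(L)=\prod_{i}\big(\mathbb{Z}+\tfrac12\mathrm{lk}(K_i,L-K_i)\big)$, with $\mathscr{U}_i$ of $A_j$-grading $-\delta_{ij}$ and $\mathscr{V}_i$ of $A_j$-grading $\delta_{ij}$. Set $U_i=\mathscr{U}_i\mathscr{V}_i$. For $\varepsilon\in\mathbb{E}_\ell=\{0,1\}^\ell$, let $S_\varepsilon$ be the multiplicative set generated by the $\mathscr{V}_i$ with $\varepsilon_i=1$. Then $\mathcal{C}_\varepsilon$ is the completion of $S_\varepsilon^{-1}\mathcal{CFL}(L)$ obtained by taking the direct product over Alexander gradings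 $\mathbf{s}\in\mathbb{H}(L)$ of the homogeneous pieces $\mathcal{C}_\varepsilon(\mathbf{s})$, completed with respect to $U_1,\dots,U_\ell$; the internal differential preserves each $\mathcal{C}_\varepsilon(\mathbf{s})$. $\mathcal{C}_\Lambda(L)=\bigoplus_\varepsilon\mathcal{C}_\varepsilon$ is an $\ell$-dimensional hypercube of chain complexes. Its differential $D$ is the sum of the internal differentials and of $\mathbb{F}[[U_1,\dots,U_\ell]]$-equivariant maps $\Phi^{\vec M}:\mathcal{C}_\varepsilon\to\mathcal{C}_{\varepsilon'}$, one for each nonempty sublink $\vec M$ of $L$ with an orientation (possibly different from that of $L$) and each pair $\varepsilon<\varepsilon'$ such that $\varepsilon'-\varepsilon$ is the indicator function of the components of $\vec M$. These maps are constructed by counting holomorphic polygons on a system of Heegaard diagrams and satisfy $$\Phi^{\vec M}(\mathcal{C}_\varepsilon(\mathbf{s}))\subseteq\mathcal{C}_{\varepsilon'}(\mathbf{s}+\Lambda_{L,\vec M}),$$ where $\Lambda_{L,\vec M}\in\mathbb{Z}^\ell\cong H_1(S^3\setminus\nu(L))$ is the sum of the framed longitudes (columns of $\Lambda$) of those components of $\vec M$ whose orientation is opposite to that from $L$. *)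

theory Defs
  imports
    "HOL-Analysis.Analysis"
    "HOL-Algebra.Free_Abelian_Groups"
    "HOL-Library.Z2"
    "HOL-Library.Function_Algebras"
begin

section \<open>Framed links in the 3-sphere\<close>

definition velocity :: "(real \<Rightarrow> 'a::real_normed_vector) \<Rightarrow> real \<Rightarrow> 'a" where
  "velocity c t = vector_derivative c (at t)"

definition smooth_curve :: "(real \<Rightarrow> 'a::real_normed_vector) \<Rightarrow> bool" where
  "smooth_curve c \<longleftrightarrow> (\<forall>k t. (velocity ^^ k) c differentiable (at t))"

text \<open>An oriented knot is a smooth embedding of the circle, written as a curve of period 1.\<close>

definition is_knot :: "(real \<Rightarrow> real ^ 4) \<Rightarrow> bool" where
  "is_knot c \<longleftrightarrow> smooth_curve c \<and> range c \<subseteq> sphere 0 1 \<and>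
     (\<forall>t. c (t + 1) = c t) \<and> inj_on c {0..<1} \<and> (\<forall>t. velocity c t \<noteq> 0)"

definition is_link :: "('n \<Rightarrow> real \<Rightarrow> real ^ 4) \<Rightarrow> bool" where
  "is_link K \<longleftrightarrow> (\<forall>i. is_knot (K i)) \<and> (\<forall>i j. i \<noteq> j \<longrightarrow> range (K i) \<inter> range (K j) = {})"

definition gauss_integral :: "(real \<Rightarrow> real ^ 3) \<Rightarrow> (real \<Rightarrow> real ^ 3) \<Rightarrow> real" where
  "gauss_integral c d = 1 / (4 * pi) *
     integral {0..1} (\<lambda>s. integral {0..1} (\<lambda>t.
       inner (c s - d t) (cross3 (velocity c s) (velocity d t)) / norm (c s - d t) ^ 3))"

text \<open>Stereographic projection from \<open>(0, 0, 0, 1)\<close>; it preserves orientation when the sphere is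
  oriented as the boundary of the unit ball.\<close>

definition stereographic :: "real ^ 4 \<Rightarrow> real ^ 3" where
  "stereographic x = (1 / (1 - x $ 4)) *\<^sub>R vector [x $ 1, x $ 2, x $ 3]"

text \<open>The linking number in the 3-sphere is the Gauss linking integral in stereographic coordinates.
  The rotation \<open>R\<close> moves the two knots off the centre of projection; the value does not depend
  on it.\<close>

definition linking_number :: "(real \<Rightarrow> real ^ 4) \<Rightarrow> (real \<Rightarrow> real ^ 4) \<Rightarrow> int" where
  "linking_number c d = (THE n. \<forall>R :: real ^ 4 ^ 4.
     rotation_matrix R \<and> axis 4 1 \<notin> (*v) R ` (range c \<union> range d) \<longrightarrow>
     gauss_integral (\<lambda>t. stereographic (R *v c t)) (\<lambda>t. stereographic (R *v d t)) = of_int n)"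

definition framing_matrix ::
    "('n::finite \<Rightarrow> real \<Rightarrow> real ^ 4) \<Rightarrow> ('n \<Rightarrow> int) \<Rightarrow> int ^ 'n ^ 'n" where
  "framing_matrix K fr = (\<chi> i j. if i = j then fr i else linking_number (K i) (K j))"


section \<open>First homology of the surgered manifold modulo torsion\<close>

definition framing_image :: "int ^ 'n ^ 'n \<Rightarrow> ('n::finite \<Rightarrow>\<^sub>0 int) set" where
  "framing_image Lam = {v. \<exists>c. \<forall>i. Poly_Mapping.lookup v i = (Lam *v c) $ i}"

text \<open>The presentation \<open>\<int>\<^sup>l / im \<Lambda>\<close> of the first homology, \<open>\<int>\<^sup>l\<close> being free on the
  meridians. Groups are written multiplicatively, as in HOL-Algebra.\<close>

definition surgery_H1 :: "int ^ 'n ^ 'n \<Rightarrow> ('n::finite \<Rightarrow>\<^sub>0 int) set monoid" where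
  "surgery_H1 Lam = free_Abelian_group UNIV Mod framing_image Lam"

definition torsion_part :: "('a, 'b) monoid_scheme \<Rightarrow> 'a set" where
  "torsion_part G = {x \<in> carrier G. \<exists>n::nat. n > 0 \<and> x [^]\<^bsub>G\<^esub> n = \<one>\<^bsub>G\<^esub>}"

definition surgery_H1_mod_tors :: "int ^ 'n ^ 'n \<Rightarrow> ('n::finite \<Rightarrow>\<^sub>0 int) set set monoid" where
  "surgery_H1_mod_tors Lam = surgery_H1 Lam Mod torsion_part (surgery_H1 Lam)"

definition meridian :: "int ^ 'n ^ 'n \<Rightarrow> 'n \<Rightarrow> ('n::finite \<Rightarrow>\<^sub>0 int) set set" where
  "meridian Lam i = torsion_part (surgery_H1 Lam) #>\<^bsub>surgery_H1 Lam\<^esub>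
     (framing_image Lam #>\<^bsub>free_Abelian_group UNIV\<^esub> frag_of i)"

text \<open>The class \<open>a\<^sub>1 \<mu>\<^sub>1 + \<dots> + a\<^sub>l \<mu>\<^sub>l\<close>.\<close>

definition meridian_combination ::
    "int ^ 'n ^ 'n \<Rightarrow> ('n \<Rightarrow> int) \<Rightarrow> ('n::finite \<Rightarrow>\<^sub>0 int) set set" where
  "meridian_combination Lam a =
     (\<Otimes>\<^bsub>surgery_H1_mod_tors Lam\<^esub>i\<in>UNIV. meridian Lam i [^]\<^bsub>surgery_H1_mod_tors Lam\<^esub> a i)"


section \<open>The link surgery complex\<close>

text \<open>
  A sublink with an orientation is a pair \<open>(P, N)\<close>: the components oriented as in \<open>L\<close> and the
  components oriented oppositely. A vertex \<open>\<epsilon>\<close> of the cube is the set \<open>E\<close> of components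
  with \<open>\<epsilon>\<^sub>i = 1\<close>.
\<close>

type_synonym 'n oriented_sublink = "'n set \<times> 'n set"

definition components :: "'n oriented_sublink \<Rightarrow> 'n set" where
  "components M = fst M \<union> snd M"

definition oriented_sublinks :: "'n oriented_sublink set" where
  "oriented_sublinks = {M. fst M \<inter> snd M = {} \<and> components M \<noteq> {}}"

text \<open>\<open>\<Lambda>\<^bsub>L,M\<^esub>\<close>\<close>

definition orientation_shift :: "int ^ 'n ^ 'n \<Rightarrow> 'n::finite oriented_sublink \<Rightarrow> int ^ 'n" where
  "orientation_shift Lam M = (\<Sum>j\<in>snd M. column j Lam)"

text \<open>
  A triple \<open>(x, u, v)\<close> stands for the monomial with \<open>U\<close>-exponents \<open>u\<close> and \<open>V\<close>-exponents
  \<open>v\<close> (of the script variables) times the intersection point \<open>x\<close>; the latter exponents may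
  be negative after localization. A chain is the family of the coefficients of all monomials.
\<close>

type_synonym ('n, 'x) monomial = "'x \<times> (nat ^ 'n) \<times> (int ^ 'n)"
type_synonym ('n, 'x) chain = "('n, 'x) monomial \<Rightarrow> bit"
type_synonym ('n, 'x) cube_chain = "'n set \<Rightarrow> ('n, 'x) chain"

text \<open>
  The holomorphic input: the intersection points with their Alexander multigrading, the number
  modulo 2 of index 1 holomorphic disks from \<open>x\<close> to \<open>y\<close> with given multiplicities
  \<open>n\<^sub>w\<close> and \<open>n\<^sub>z\<close>, and for an oriented sublink \<open>M\<close> and a vertex \<open>E\<close> the
  structure map with source \<open>C\<^sub>E\<close>.
\<close>

record ('n, 'x) surgery_data =
  points :: "'x set"
  alexander :: "'x \<Rightarrow> rat ^ 'n"
  disk_count :: "'x \<Rightarrow> 'x \<Rightarrow> nat ^ 'n \<Rightarrow> nat ^ 'n \<Rightarrow> bit"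
  Phi :: "'n oriented_sublink \<Rightarrow> 'n set \<Rightarrow> ('n, 'x) chain \<Rightarrow> ('n, 'x) chain"

definition alexander_lattice :: "('n::finite \<Rightarrow> real \<Rightarrow> real ^ 4) \<Rightarrow> (rat ^ 'n) set" where
  "alexander_lattice K =
     {s. \<forall>i. s $ i - of_int (\<Sum>j\<in>UNIV - {i}. linking_number (K i) (K j)) / 2 \<in> \<int>}"

definition of_nat_vec :: "nat ^ 'n \<Rightarrow> 'a::semiring_1 ^ 'n" where
  "of_nat_vec u = (\<chi> i. of_nat (u $ i))"

definition of_int_vec :: "int ^ 'n \<Rightarrow> 'a::ring_1 ^ 'n" where
  "of_int_vec v = (\<chi> i. of_int (v $ i))"

definition monomial_grading ::
    "('n, 'x) surgery_data \<Rightarrow> ('n::finite, 'x) monomial \<Rightarrow> rat ^ 'n" where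
  "monomial_grading X = (\<lambda>(x, u, v). alexander X x - of_nat_vec u + of_int_vec v)"

definition monomials :: "('n, 'x) surgery_data \<Rightarrow> 'n set \<Rightarrow> ('n::finite, 'x) monomial set" where
  "monomials X E = {(x, u, v). x \<in> points X \<and> (\<forall>i. i \<notin> E \<longrightarrow> 0 \<le> v $ i)}"

text \<open>
  The completed localization \<open>C\<^sub>E\<close>. In a fixed Alexander grading \<open>s\<close>, the pair \<open>(x, u)\<close>
  determines the monomial, so the homogeneous piece of the localization is a free
  \<open>\<F>[U\<^sub>1, \<dots>, U\<^sub>l]\<close>-module of finite rank (there are finitely many points), whose completion
  consists of arbitrary families of coefficients of the monomials of grading \<open>s\<close>. The direct
  product over \<open>s\<close> therefore consists of arbitrary families of coefficients of all monomials.
\<close>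

definition vertex_complex :: "('n, 'x) surgery_data \<Rightarrow> 'n set \<Rightarrow> ('n::finite, 'x) chain set" where
  "vertex_complex X E = {f. \<forall>m. f m \<noteq> 0 \<longrightarrow> m \<in> monomials X E}"

definition graded_piece ::
    "('n, 'x) surgery_data \<Rightarrow> 'n set \<Rightarrow> rat ^ 'n \<Rightarrow> ('n::finite, 'x) chain set" where
  "graded_piece X E s = {f \<in> vertex_complex X E. \<forall>m. f m \<noteq> 0 \<longrightarrow> monomial_grading X m = s}"

definition graded_part ::
    "('n, 'x) surgery_data \<Rightarrow> rat ^ 'n \<Rightarrow> ('n, 'x) chain \<Rightarrow> ('n::finite, 'x) chain" where
  "graded_part X s f = (\<lambda>m. if monomial_grading X m = s then f m else 0)"

definition internal_diff ::
    "('n, 'x) surgery_data \<Rightarrow> ('n, 'x) chain \<Rightarrow> ('n::finite, 'x) chain" where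
  "internal_diff X f = (\<lambda>(y, u, v).
     \<Sum>x\<in>points X. \<Sum>(k, l) | k \<le> u \<and> disk_count X x y k l \<noteq> 0.
       disk_count X x y k l * f (x, u - k, v - of_nat_vec l))"

text \<open>A power series in \<open>U\<^sub>1, \<dots>, U\<^sub>l\<close> is given by its coefficients; each \<open>U\<^sub>i\<close> acts as the
  product of the two script variables with index \<open>i\<close>.\<close>

definition power_series_act ::
    "(nat ^ 'n \<Rightarrow> bit) \<Rightarrow> ('n, 'x) chain \<Rightarrow> ('n::finite, 'x) chain" where
  "power_series_act p f =
     (\<lambda>(x, u, v). \<Sum>k | k \<le> u. p k * f (x, u - k, v - of_nat_vec k))"

definition equivariant_map ::
    "('p \<Rightarrow> 'a \<Rightarrow> 'a) \<Rightarrow> ('p \<Rightarrow> 'b \<Rightarrow> 'b) \<Rightarrow> 'a::plus set \<Rightarrow> 'b::plus set \<Rightarrow> ('a \<Rightarrow> 'b) \<Rightarrow> bool" where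
  "equivariant_map actA actB A B h \<longleftrightarrow>
     (\<forall>f\<in>A. h f \<in> B) \<and> (\<forall>f\<in>A. \<forall>g\<in>A. h (f + g) = h f + h g) \<and>
     (\<forall>p. \<forall>f\<in>A. h (actA p f) = actB p (h f))"

definition total_complex :: "('n, 'x) surgery_data \<Rightarrow> ('n::finite, 'x) cube_chain set" where
  "total_complex X = {f. \<forall>E. f E \<in> vertex_complex X E}"

definition total_act ::
    "(nat ^ 'n \<Rightarrow> bit) \<Rightarrow> ('n, 'x) cube_chain \<Rightarrow> ('n::finite, 'x) cube_chain" where
  "total_act p f = (\<lambda>E. power_series_act p (f E))"

text \<open>All structure maps for \<open>M\<close>, assembled into an endomorphism of the total complex.\<close>

definition total_Phi :: "('n, 'x) surgery_data \<Rightarrow> 'n oriented_sublink \<Rightarrow>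
    ('n, 'x) cube_chain \<Rightarrow> ('n::finite, 'x) cube_chain" where
  "total_Phi X M f = (\<lambda>E. if components M \<subseteq> E
     then Phi X M (E - components M) (f (E - components M)) else 0)"

definition surgery_diff ::
    "('n, 'x) surgery_data \<Rightarrow> ('n, 'x) cube_chain \<Rightarrow> ('n::finite, 'x) cube_chain" where
  "surgery_diff X f =
     (\<lambda>E. internal_diff X (f E)) + (\<Sum>M\<in>oriented_sublinks. total_Phi X M f)"

definition is_surgery_complex :: "('n::finite \<Rightarrow> real \<Rightarrow> real ^ 4) \<Rightarrow> ('n \<Rightarrow> int) \<Rightarrow>
    ('n, 'x) surgery_data \<Rightarrow> bool" where
  "is_surgery_complex K fr X \<longleftrightarrow>
     finite (points X) \<and>
     (\<forall>x\<in>points X. alexander X x \<in> alexander_lattice K) \<and>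
     (\<forall>x\<in>points X. \<forall>y\<in>points X. finite {(k, l). disk_count X x y k l \<noteq> 0}) \<and>
     (\<forall>x y k l. disk_count X x y k l \<noteq> 0 \<longrightarrow> x \<in> points X \<and> y \<in> points X \<and>
        alexander X y - of_nat_vec k + of_nat_vec l = alexander X x) \<and>
     (\<forall>M\<in>oriented_sublinks. \<forall>E. E \<inter> components M = {} \<longrightarrow>
        equivariant_map power_series_act power_series_act
          (vertex_complex X E) (vertex_complex X (E \<union> components M)) (Phi X M E) \<and>
        (\<forall>s\<in>alexander_lattice K.
          let s' = s + of_int_vec (orientation_shift (framing_matrix K fr) M) in
            Phi X M E ` graded_piece X E s \<subseteq> graded_piece X (E \<union> components M) s' \<and>
            \<comment> \<open>on the direct product, the map is the product of its homogeneous pieces\<close>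
            (\<forall>f\<in>vertex_complex X E.
              graded_part X s' (Phi X M E f) = Phi X M E (graded_part X s f)))) \<and>
     (\<forall>f\<in>total_complex X. surgery_diff X (surgery_diff X f) = 0)"


section \<open>The homology action\<close>

text \<open>\<open>F\<^bsup>K\<^sub>i\<^esup>\<close>\<close>

definition knot_map ::
    "('n, 'x) surgery_data \<Rightarrow> 'n \<Rightarrow> ('n, 'x) cube_chain \<Rightarrow> ('n::finite, 'x) cube_chain" where
  "knot_map X i f = (\<Sum>M | M \<in> oriented_sublinks \<and> i \<in> fst M. total_Phi X M f)"

definition homology_action :: "('n, 'x) surgery_data \<Rightarrow> ('n \<Rightarrow> int) \<Rightarrow>
    ('n, 'x) cube_chain \<Rightarrow> ('n::finite, 'x) cube_chain" where
  "homology_action X a f = (\<Sum>i\<in>UNIV. (\<lambda>E m. of_int (a i) * knot_map X i f E m))"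

definition equivariant_endo ::
    "('n, 'x) surgery_data \<Rightarrow> (('n, 'x) cube_chain \<Rightarrow> ('n::finite, 'x) cube_chain) \<Rightarrow> bool" where
  "equivariant_endo X h \<longleftrightarrow>
     equivariant_map total_act total_act (total_complex X) (total_complex X) h"

definition equivariantly_homotopic :: "('n, 'x) surgery_data \<Rightarrow>
    (('n, 'x) cube_chain \<Rightarrow> ('n, 'x) cube_chain) \<Rightarrow>
    (('n, 'x) cube_chain \<Rightarrow> ('n::finite, 'x) cube_chain) \<Rightarrow> bool" where
  "equivariantly_homotopic X g h \<longleftrightarrow> equivariant_endo X g \<and> equivariant_endo X h \<and>
     (\<exists>J. equivariant_endo X J \<and>
       (\<forall>f\<in>total_complex X. g f - h f = surgery_diff X (J f) + J (surgery_diff X f)))"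

end

theory Submission
  imports Defs
begin

text \<open>
  Suppose that \<open>a\<close> and \<open>b\<close> give the same class modulo torsion and put \<open>d = a - b\<close>. A positive multiple
  of \<open>d\<close> is then in the image of the framing matrix, \<open>n d = \<Lambda> c\<close> (\<open>meridian_combination_eqD\<close>), and the
  task is to show that \<open>\<Sum>\<^sub>i d\<^sub>i F\<^bsup>K\<^sub>i\<^esup>\<close> is null-homotopic. Its component for an oriented sublink \<open>M\<close>
  is \<open>\<Phi>\<^bsup>M\<^esup>\<close> times the sum of the \<open>d\<^sub>i\<close> over the positively oriented components of \<open>M\<close>
  (\<open>homology_action_eq_sum\<close>).

  The null-homotopy is diagonal: it multiplies the piece of Alexander grading \<open>s\<close> at the vertex \<open>E\<close> by
  an integer \<open>w(E, s)\<close> modulo 2. Internal differentials and the action of the \<open>U\<^sub>i\<close> preserve \<open>s\<close> and so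
  commute with it, whereas \<open>\<Phi>\<^bsup>M\<^esup>\<close> shifts \<open>s\<close> by the framed longitudes of the negatively oriented
  components of \<open>M\<close> and adds all components of \<open>M\<close> to \<open>E\<close>. Hence the commutator of \<open>D\<close> with the
  operator is the sum of the \<open>\<Phi>\<^bsup>M\<^esup>\<close>, each multiplied by the increment of \<open>w\<close> along this move
  (\<open>surgery_diff_reweight_commutator\<close>). Take
  \<open>w(E, s) = \<lfloor>(c \<cdot> s) / n\<rfloor> + \<Sum>\<^bsub>j \<in> E\<^esub> d\<^sub>j\<close>.
  As \<open>\<Lambda>\<close> is symmetric, the functional \<open>(c \<cdot> s) / n\<close> takes the value \<open>d\<^sub>j\<close> on the \<open>j\<close>-th column of
  \<open>\<Lambda>\<close> (\<open>orientation_shift_pairing\<close>). So the first summand of \<open>w\<close> grows by the sum of the \<open>d\<^sub>j\<close> over the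
  negative components of \<open>M\<close>, and the second by the sum over all components. Modulo 2, the sum over the
  positive components remains.

  The symmetry of \<open>\<Lambda>\<close> is the symmetry of the linking number, which for the Gauss integral is an
  exchange of the order of integration.
\<close>

section \<open>Symmetry of the framing matrix\<close>

text \<open>The integrand is symmetric under exchanging the two curves: both the difference vector and the
  cross product change sign. What remains is to exchange the order of integration.\<close>

lemma gauss_integral_commute:
  assumes cont: "continuous_on {0..1} c" "continuous_on {0..1} d"
      "continuous_on {0..1} (velocity c)" "continuous_on {0..1} (velocity d)"
    and disjoint: "c ` {0..1} \<inter> d ` {0..1} = {}"
  shows "gauss_integral c d = gauss_integral d c"
proof -
  let ?f = "\<lambda>s t. inner (c s - d t) (cross3 (velocity c s) (velocity d t)) / norm (c s - d t) ^ 3"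
  have fst: "continuous_on (cbox (0, 0) (1, 1)) (\<lambda>p. h (fst p))"
    and snd: "continuous_on (cbox (0, 0) (1, 1)) (\<lambda>p. h (snd p))"
    if "continuous_on {0..1} h" for h :: "real \<Rightarrow> real ^ 3"
    using that by (auto intro!: continuous_on_compose2[of "{0..1}" h] continuous_intros
        simp: cbox_Pair_eq)
  have "c s \<noteq> d t" if "s \<in> {0..1}" "t \<in> {0..1}" for s t
    using disjoint that by blast
  then have "continuous_on (cbox (0, 0) (1, 1)) (\<lambda>(s, t). ?f s t)"
    unfolding case_prod_unfold
    by (intro continuous_intros continuous_on_cross fst snd cont) (auto simp: cbox_Pair_eq)
  then have "integral {0..1} (\<lambda>s. integral {0..1} (?f s)) =
      integral {0..1} (\<lambda>t. integral {0..1} (\<lambda>s. ?f s t))"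
    using integral_swap_continuous[of 0 0 1 1 ?f] by simp
  moreover have "?f s t = inner (d t - c s) (cross3 (velocity d t) (velocity c s)) / norm (d t - c s) ^ 3"
    for s t
    using cross_skew[of "velocity c s" "velocity d t"]
    by (simp add: norm_minus_commute inner_diff_left)
  ultimately show ?thesis
    by (simp add: gauss_integral_def)
qed

text \<open>Disjoint curves on the sphere must stay disjoint after projection, since otherwise the Gauss
  integrand is not continuous.\<close>

lemma stereographic_inject:
  assumes "norm x = 1" "norm y = 1" "x $ 4 \<noteq> 1" "y $ 4 \<noteq> 1"
    and "stereographic x = stereographic y"
  shows "x = y"
proof -
  have sq: "(z $ 1)\<^sup>2 + (z $ 2)\<^sup>2 + (z $ 3)\<^sup>2 + (z $ 4)\<^sup>2 = 1" if "norm z = 1" for z :: "real ^ 4"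
    using that by (simp add: norm_vec_def L2_set_def sum_4)
  define p where "p = 1 - x $ 4"
  define q where "q = 1 - y $ 4"
  have pq: "p \<noteq> 0" "q \<noteq> 0" using assms by (auto simp: p_def q_def)
  have e: "x $ 1 * q = y $ 1 * p" "x $ 2 * q = y $ 2 * p" "x $ 3 * q = y $ 3 * p"
    using assms(5) pq by (auto simp: stereographic_def vec_eq_iff forall_3 field_simps simp flip: p_def q_def)
  have xs: "(x $ 1)\<^sup>2 + (x $ 2)\<^sup>2 + (x $ 3)\<^sup>2 = p * (2 - p)"
    using sq[OF assms(1)] by (simp add: p_def power2_eq_square algebra_simps)
  have ys: "(y $ 1)\<^sup>2 + (y $ 2)\<^sup>2 + (y $ 3)\<^sup>2 = q * (2 - q)"
    using sq[OF assms(2)] by (simp add: q_def power2_eq_square algebra_simps)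
  \<comment> \<open>Proportional horizontal parts turn the two sphere equations into one equation for the heights.\<close>
  have "q\<^sup>2 * (p * (2 - p)) = p\<^sup>2 * (q * (2 - q))"
    unfolding xs[symmetric] ys[symmetric] using e
    by (simp add: distrib_left mult.commute flip: power_mult_distrib)
  then have "p = q" using pq by (simp add: power2_eq_square algebra_simps)
  then show ?thesis
    using e pq by (auto simp: vec_eq_iff forall_4 p_def q_def)
qed

lemma stereographic_curve_C1:
  fixes y :: "real \<Rightarrow> real ^ 4"
  assumes diff: "\<And>t. y differentiable (at t)" and cont: "continuous_on UNIV (velocity y)"
    and off: "\<And>t. y t $ 4 \<noteq> 1"
  shows "continuous_on UNIV (\<lambda>t. stereographic (y t))"
    and "continuous_on UNIV (velocity (\<lambda>t. stereographic (y t)))"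
proof -
  define P where "P = (\<lambda>x :: real ^ 4. vector [x $ 1, x $ 2, x $ 3] :: real ^ 3)"
  have P: "bounded_linear P"
    unfolding P_def linear_conv_bounded_linear[symmetric]
    by (rule linearI) (simp_all add: vec_eq_iff forall_3)
  have y: "(y has_vector_derivative velocity y t) (at t)" for t
    using diff[of t] by (simp add: velocity_def vector_derivative_works[symmetric])
  have conty: "continuous_on UNIV y"
    using diff by (simp add: continuous_on_eq_continuous_at differentiable_imp_continuous_within)
  have y4: "((\<lambda>t. y t $ 4) has_vector_derivative velocity y t $ 4) (at t)" for t
    using bounded_linear.has_vector_derivative[OF bounded_linear_vec_nth y] .
  have st: "stereographic x = inverse (1 - x $ 4) *\<^sub>R P x" for x
    by (simp add: stereographic_def P_def inverse_eq_divide)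
  \<comment> \<open>the derivative of the quotient, visibly continuous\<close>
  define D where "D t = inverse (1 - y t $ 4) *\<^sub>R P (velocity y t) +
      (velocity y t $ 4 * inverse ((1 - y t $ 4)\<^sup>2)) *\<^sub>R P (y t)" for t
  have "((\<lambda>t. stereographic (y t)) has_vector_derivative D t) (at t)" for t
  proof -
    have "((\<lambda>t. inverse (1 - y t $ 4)) has_real_derivative velocity y t $ 4 * inverse ((1 - y t $ 4)\<^sup>2)) (at t)"
      using y4[of t] off[of t]
      by (auto intro!: derivative_eq_intros simp: has_real_derivative_iff_has_vector_derivative[symmetric] power2_eq_square field_simps)
    from has_vector_derivative_scaleR[OF this bounded_linear.has_vector_derivative[OF P y]]
    show ?thesis unfolding st D_def .
  qed
  then have "velocity (\<lambda>t. stereographic (y t)) = D"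
    unfolding velocity_def by (intro ext vector_derivative_at)
  moreover have off': "\<And>t. 1 - y t $ 4 \<noteq> 0" using off by simp
  have "continuous_on UNIV D"
    unfolding D_def using off'
    by (intro continuous_intros bounded_linear.continuous_on[OF P] conty cont) auto
  ultimately show "continuous_on UNIV (velocity (\<lambda>t. stereographic (y t)))" by simp
  show "continuous_on UNIV (\<lambda>t. stereographic (y t))"
    unfolding st using off'
    by (intro continuous_intros bounded_linear.continuous_on[OF P] conty) auto
qed

lemma rotated_knot:
  fixes R :: "real ^ 4 ^ 4"
  assumes "is_knot c" and R: "rotation_matrix R" and off: "axis 4 1 \<notin> (*v) R ` range c"
  shows "norm (R *v c t) = 1" and "(R *v c t) $ 4 \<noteq> 1"
    and "continuous_on UNIV (\<lambda>t. stereographic (R *v c t))"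
    and "continuous_on UNIV (velocity (\<lambda>t. stereographic (R *v c t)))"
proof -
  have n: "norm (R *v c t) = 1" for t
  proof -
    have "orthogonal_transformation ((*v) R)"
      using R by (simp add: rotation_matrix_def orthogonal_transformation_matrix)
    then show ?thesis
      using assms(1) by (force simp: is_knot_def orthogonal_transformation)
  qed
  show "norm (R *v c t) = 1" by (rule n)
  have o: "(R *v c t) $ 4 \<noteq> 1" for t
  proof
    \<comment> \<open>the pole is the only point of the unit sphere with last coordinate 1\<close>
    assume 4: "(R *v c t) $ 4 = 1"
    have "((R *v c t) $ 1)\<^sup>2 + ((R *v c t) $ 2)\<^sup>2 + ((R *v c t) $ 3)\<^sup>2 = 0"
      using n[of t] 4 by (simp add: norm_vec_def L2_set_def sum_4)
    then have "R *v c t = axis 4 1"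
      using 4 by (simp add: vec_eq_iff forall_4 axis_def sum_power2_eq_zero_iff add_nonneg_eq_0_iff)
    then show False using off by (metis rangeI image_eqI)
  qed
  show "(R *v c t) $ 4 \<noteq> 1" by (rule o)
  have sm: "(velocity ^^ k) c differentiable (at t)" for k t
    using assms(1) by (simp add: is_knot_def smooth_curve_def)
  have c: "(c has_vector_derivative velocity c t) (at t)" for t
    using sm[of 0 t] by (simp add: velocity_def vector_derivative_works[symmetric])
  have Rc: "((\<lambda>t. R *v c t) has_vector_derivative R *v velocity c t) (at t)" for t
    using bounded_linear.has_vector_derivative[OF matrix_vector_mul_bounded_linear c] .
  then have v: "velocity (\<lambda>t. R *v c t) = (\<lambda>t. R *v velocity c t)"
    unfolding velocity_def[of "\<lambda>t. R *v c t"] by (intro ext vector_derivative_at)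
  have "continuous_on UNIV (velocity c)"
    using sm[of 1] by (simp add: continuous_on_eq_continuous_at differentiable_imp_continuous_within)
  then have cv: "continuous_on UNIV (velocity (\<lambda>t. R *v c t))"
    unfolding v by (intro bounded_linear.continuous_on[OF matrix_vector_mul_bounded_linear])
  have d: "(\<lambda>t. R *v c t) differentiable (at t)" for t
    using Rc differentiableI_vector by blast
  show "continuous_on UNIV (\<lambda>t. stereographic (R *v c t))"
    "continuous_on UNIV (velocity (\<lambda>t. stereographic (R *v c t)))"
    using stereographic_curve_C1[OF d cv o] by auto
qed

text \<open>The two definite descriptions agree because their defining predicates do, rotation by rotation:
  for each admissible rotation the two Gauss integrals are equal.\<close>

lemma linking_number_commute:
  assumes "is_knot c" "is_knot d" "range c \<inter> range d = {}"
  shows "linking_number c d = linking_number d c"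
proof -
  have "gauss_integral (\<lambda>t. stereographic (R *v c t)) (\<lambda>t. stereographic (R *v d t)) =
      gauss_integral (\<lambda>t. stereographic (R *v d t)) (\<lambda>t. stereographic (R *v c t))"
    if R: "rotation_matrix R" and "axis 4 1 \<notin> (*v) R ` (range c \<union> range d)" for R :: "real ^ 4 ^ 4"
  proof -
    have offc: "axis 4 1 \<notin> (*v) R ` range c" and offd: "axis 4 1 \<notin> (*v) R ` range d" using that by auto
    note c = rotated_knot[OF assms(1) R offc] and d = rotated_knot[OF assms(2) R offd]
    have "inj ((*v) R)"
      using R by (auto simp: rotation_matrix_def orthogonal_matrix_def invertible_def
          intro!: invertible_eq_bij[THEN iffD1, THEN bij_is_inj])
    then have "stereographic (R *v c s) \<noteq> stereographic (R *v d t)" for s t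
      using stereographic_inject[OF c(1) d(1) c(2) d(2), of s t] assms(3)
      by (metis disjoint_iff injD rangeI)
    then show ?thesis
      by (intro gauss_integral_commute continuous_on_subset[OF c(3)] continuous_on_subset[OF d(3)]
          continuous_on_subset[OF c(4)] continuous_on_subset[OF d(4)]) auto
  qed
  then show ?thesis
    unfolding linking_number_def by (simp add: Un_commute cong: conj_cong imp_cong)
qed

lemma framing_matrix_symmetric:
  assumes "is_link K"
  shows "transpose (framing_matrix K fr) = framing_matrix K fr"
  using assms linking_number_commute
  by (fastforce simp: is_link_def transpose_def framing_matrix_def vec_eq_iff)

section \<open>Relations among the meridians modulo torsion\<close>

definition frag_of_coeffs :: "('n::finite \<Rightarrow> int) \<Rightarrow> 'n \<Rightarrow>\<^sub>0 int" where
  "frag_of_coeffs a = Poly_Mapping.Abs_poly_mapping a"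

lemma lookup_frag_of_coeffs [simp]: "Poly_Mapping.lookup (frag_of_coeffs a) i = a i"
  by (simp add: frag_of_coeffs_def)

lemma frag_of_coeffs_eq_sum: "frag_of_coeffs a = (\<Sum>i\<in>UNIV. frag_cmul (a i) (frag_of i))"
  by (rule poly_mapping_eqI) (simp add: lookup_sum lookup_single when_def if_distrib cong: if_cong)

lemma subgroup_framing_image: "subgroup (framing_image Lam) (free_Abelian_group UNIV)"
proof (rule group.subgroupI)
  show "framing_image Lam \<noteq> {}"
    unfolding framing_image_def by (auto intro!: exI[of _ 0])
  show "inv\<^bsub>free_Abelian_group UNIV\<^esub> v \<in> framing_image Lam" if v: "v \<in> framing_image Lam" for v
  proof -
    obtain c where "\<forall>i. Poly_Mapping.lookup v i = (Lam *v c) $ i"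
      using v by (auto simp: framing_image_def)
    then have "\<forall>i. Poly_Mapping.lookup (- v) i = (Lam *v (- c)) $ i"
      by (simp add: matrix_vector_mult_def sum_negf)
    then show ?thesis by (auto simp: framing_image_def)
  qed
  show "v \<otimes>\<^bsub>free_Abelian_group UNIV\<^esub> w \<in> framing_image Lam"
    if vw: "v \<in> framing_image Lam" "w \<in> framing_image Lam" for v w
  proof -
    obtain c d where "\<forall>i. Poly_Mapping.lookup v i = (Lam *v c) $ i"
      "\<forall>i. Poly_Mapping.lookup w i = (Lam *v d) $ i"
      using vw by (auto simp: framing_image_def)
    then have "\<forall>i. Poly_Mapping.lookup (v + w) i = (Lam *v (c + d)) $ i"
      by (simp add: lookup_add matrix_vector_right_distrib)
    then show ?thesis by (auto simp: framing_image_def)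
  qed
qed auto

lemma (in comm_group) subgroup_torsion_part: "subgroup (torsion_part G) G"
proof (rule subgroupI)
  show "torsion_part G \<noteq> {}"
    unfolding torsion_part_def using one_closed by (auto intro!: exI[of _ "1::nat"])
  show "inv x \<in> torsion_part G" if "x \<in> torsion_part G" for x
    using that by (auto simp: torsion_part_def nat_pow_inv)
  show "x \<otimes> y \<in> torsion_part G" if xy: "x \<in> torsion_part G" "y \<in> torsion_part G" for x y
  proof -
    obtain m n :: nat where mn: "m > 0" "x [^] m = \<one>" "n > 0" "y [^] n = \<one>"
      and xy: "x \<in> carrier G" "y \<in> carrier G"
      using xy by (auto simp: torsion_part_def)
    have "(x \<otimes> y) [^] (m * n) = (x [^] m) [^] n \<otimes> (y [^] n) [^] m"
      using xy by (simp add: pow_mult_distrib m_comm nat_pow_pow mult.commute)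
    then have "m * n > 0 \<and> (x \<otimes> y) [^] (m * n) = \<one>" using mn by simp
    then show ?thesis
      unfolding torsion_part_def using xy by blast
  qed
qed (auto simp: torsion_part_def)

lemma hom_finprod:
  assumes "h \<in> hom G H" "comm_group G" "comm_group H" "f \<in> A \<rightarrow> carrier G"
  shows "h (finprod G f A) = finprod H (\<lambda>x. h (f x)) A"
proof -
  interpret G: comm_group G by fact
  interpret H: comm_group H by fact
  have h: "h x \<in> carrier H" if "x \<in> carrier G" for x
    using assms(1) that by (auto simp: hom_def)
  show ?thesis
    using assms(4)
  proof (induction A rule: infinite_finite_induct)
    case (insert x F)
    then have "f x \<in> carrier G" "f \<in> F \<rightarrow> carrier G" by auto
    moreover have "(\<lambda>x. h (f x)) \<in> F \<rightarrow> carrier H" using insert h by auto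
    ultimately show ?case
      using insert h hom_mult[OF assms(1)] by simp
  qed (use hom_one[OF assms(1)] G.is_group H.is_group in auto)
qed

lemma (in normal) coset_eq_imp_div_mem:
  assumes "x \<in> carrier G" "y \<in> carrier G" "H #> x = H #> y"
  shows "x \<otimes> inv y \<in> H"
  using rcos_self[OF assms(1) subgroup_axioms] rcos_module[OF is_group, of y x] assms by simp

text \<open>The class of a combination of meridians is the image of its coefficient vector under two
  successive quotient maps. Equality in the second quotient says that the difference is torsion in
  the first, hence that a positive multiple of it lies in the image of the framing matrix.\<close>

lemma meridian_combination_eqD:
  assumes "meridian_combination Lam a = meridian_combination Lam b"
  obtains n c where "n > 0" "\<And>i. int n * (a i - b i) = (Lam *v c) $ i"
proof -
  let ?F = "free_Abelian_group UNIV :: ('n \<Rightarrow>\<^sub>0 int) monoid"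
  let ?G = "surgery_H1 Lam" and ?H = "surgery_H1_mod_tors Lam"
  let ?I = "framing_image Lam" and ?T = "torsion_part ?G"
  interpret F: comm_group ?F by (rule abelian_free_Abelian_group)
  interpret I: normal ?I ?F
    using F.subgroup_imp_normal[OF subgroup_framing_image] .
  interpret G: comm_group ?G
    unfolding surgery_H1_def by (rule F.abelian_FactGroup[OF subgroup_framing_image])
  interpret T: normal ?T ?G
    using G.subgroup_imp_normal[OF G.subgroup_torsion_part] .
  interpret H: comm_group ?H
    unfolding surgery_H1_mod_tors_def by (rule G.abelian_FactGroup[OF G.subgroup_torsion_part])
  define p where "p x = ?I #>\<^bsub>?F\<^esub> x" for x
  define q where "q x = ?T #>\<^bsub>?G\<^esub> x" for x
  have p: "p \<in> hom ?F ?G"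
    unfolding p_def surgery_H1_def by (rule I.r_coset_hom_Mod)
  have q: "q \<in> hom ?G ?H"
    unfolding q_def surgery_H1_mod_tors_def by (rule T.r_coset_hom_Mod)
  have qp: "(\<lambda>x. q (p x)) \<in> hom ?F ?H"
    using hom_compose[OF p q] by (simp add: comp_def)
  have p_carrier: "p x \<in> carrier ?G" for x
    using hom_carrier[OF p] by auto
  have combination: "meridian_combination Lam e = q (p (frag_of_coeffs e))" for e
  proof -
    have F_sum: "finprod ?F (\<lambda>i. frag_of i [^]\<^bsub>?F\<^esub> e i) A = (\<Sum>i\<in>A. frag_cmul (e i) (frag_of i))"
      if "finite A" for A
      using that by induction auto
    have "meridian_combination Lam e = (\<Otimes>\<^bsub>?H\<^esub>i\<in>UNIV. q (p (frag_of i [^]\<^bsub>?F\<^esub> e i)))"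
      unfolding meridian_combination_def meridian_def
      by (simp add: hom_int_pow[OF qp] del: int_pow_free_Abelian_group flip: p_def q_def)
    also have "\<dots> = q (p (finprod ?F (\<lambda>i. frag_of i [^]\<^bsub>?F\<^esub> e i) UNIV))"
      by (rule hom_finprod[OF qp F.comm_group_axioms H.comm_group_axioms, symmetric]) auto
    finally show ?thesis by (simp only: F_sum[OF finite] frag_of_coeffs_eq_sum)
  qed
  let ?x = "frag_of_coeffs a - frag_of_coeffs b"
  have "p (frag_of_coeffs a) \<otimes>\<^bsub>?G\<^esub> inv\<^bsub>?G\<^esub> p (frag_of_coeffs b) \<in> ?T"
    using assms combination p_carrier by (intro T.coset_eq_imp_div_mem) (auto simp: q_def)
  also have "p (frag_of_coeffs a) \<otimes>\<^bsub>?G\<^esub> inv\<^bsub>?G\<^esub> p (frag_of_coeffs b) = p ?x"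
  proof -
    interpret P: group_hom ?F ?G p
      using p by unfold_locales
    show ?thesis
      by (simp flip: P.hom_inv P.hom_mult)
  qed
  finally obtain n :: nat where n: "n > 0" "p ?x [^]\<^bsub>?G\<^esub> n = \<one>\<^bsub>?G\<^esub>"
    unfolding torsion_part_def by blast
  let ?y = "frag_cmul (int n) ?x"
  have "p ?y = p (?x [^]\<^bsub>?F\<^esub> n)"
    by (simp only: pow_free_Abelian_group)
  also have "\<dots> = p ?x [^]\<^bsub>?G\<^esub> n"
    by (rule hom_nat_pow[OF p _ F.is_group G.is_group]) simp
  also have "\<dots> = ?I"
    unfolding n(2) by (simp add: surgery_H1_def)
  finally have "?I #>\<^bsub>?F\<^esub> ?y = ?I"
    by (simp only: p_def)
  moreover have "?y \<in> ?I #>\<^bsub>?F\<^esub> ?y"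
    by (rule F.rcos_self[OF _ subgroup_framing_image]) simp
  ultimately have "?y \<in> ?I"
    by (simp only:)
  then obtain c where c: "\<And>i. Poly_Mapping.lookup ?y i = (Lam *v c) $ i"
    unfolding framing_image_def by blast
  have "int n * (a i - b i) = (Lam *v c) $ i" for i
    unfolding c[symmetric] by (simp add: lookup_minus)
  with n(1) show ?thesis by (rule that)
qed

section \<open>Diagonal operators on the surgery complex\<close>

text \<open>By default the simplifier rewrites arithmetic in the field with two elements to Boolean
  operations, which hides the linear structure that the computations below rely on.\<close>

declare add_bit_eq_xor [simp del] mult_bit_eq_and [simp del] bit_not_zero_iff [simp del]

lemma sum_fun_apply: "(\<Sum>i\<in>A. f i) x = (\<Sum>i\<in>A. f i x)"
  by (induction A rule: infinite_finite_induct) auto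

lemma bit_add_self [simp]: "(x::bit) + x = 0" "x + (x + y) = y"
proof -
  show "x + x = 0" by (cases x) simp_all
  then show "x + (x + y) = y" by (simp flip: add.assoc)
qed

text \<open>The diagonal operator that multiplies the homogeneous piece of grading \<open>s\<close> at the vertex \<open>E\<close> by
  \<open>w E s\<close>. The null-homotopy of the homology action of a null class has this form.\<close>

definition reweight :: "('n, 'x) surgery_data \<Rightarrow> ('n set \<Rightarrow> rat ^ 'n \<Rightarrow> bit) \<Rightarrow>
    ('n, 'x) cube_chain \<Rightarrow> ('n::finite, 'x) cube_chain" where
  "reweight X w f = (\<lambda>E m. w E (monomial_grading X m) * f E m)"

lemma reweight_apply: "reweight X w f E m = w E (monomial_grading X m) * f E m"
  by (simp add: reweight_def)

lemma of_nat_vec_diff: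
  assumes "k \<le> u"
  shows "of_nat_vec (u - k) = (of_nat_vec u - of_nat_vec k :: rat ^ 'n)"
  using assms by (simp add: of_nat_vec_def vec_eq_iff less_eq_vec_def of_nat_diff)

lemma of_int_vec_diff: "of_int_vec (v - w) = of_int_vec v - of_int_vec w"
  by (simp add: of_int_vec_def vec_eq_iff)

lemma of_int_vec_of_nat_vec [simp]: "of_int_vec (of_nat_vec k) = of_nat_vec k"
  by (simp add: of_int_vec_def of_nat_vec_def vec_eq_iff)

text \<open>The two script variables with index \<open>i\<close> have opposite Alexander gradings, so power series in
  the \<open>U\<^sub>i\<close> preserve the grading; this makes diagonal operators equivariant.\<close>

lemma monomial_grading_times_U:
  assumes "k \<le> u"
  shows "monomial_grading X (x, u - k, v - of_nat_vec k) = monomial_grading X (x, u, v)"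
  using assms by (simp add: monomial_grading_def of_nat_vec_diff of_int_vec_diff)

lemma monomial_grading_in_lattice:
  assumes "\<forall>x\<in>points X. alexander X x \<in> alexander_lattice K" "m \<in> monomials X E"
  shows "monomial_grading X m \<in> alexander_lattice K"
proof -
  obtain x u v where m: "m = (x, u, v)" by (cases m)
  have "alexander X x $ i - r \<in> \<int> \<Longrightarrow> alexander X x $ i - of_nat n + of_int z - r \<in> \<int>" for i r n z
    by (drule Ints_add[OF _ Ints_of_int[of "z - int n"]]) (simp add: algebra_simps)
  then show ?thesis
    using assms by (auto simp: m monomials_def monomial_grading_def alexander_lattice_def
        of_nat_vec_def of_int_vec_def)
qed

lemma alexander_lattice_add_of_int_vec_iff:
  "s + of_int_vec v \<in> alexander_lattice K \<longleftrightarrow> s \<in> alexander_lattice K"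
proof -
  have "s $ i + of_int z - r \<in> \<int> \<longleftrightarrow> s $ i - r \<in> \<int>" for i z r
    using Ints_add[of "s $ i - r" "of_int z"] Ints_diff[of "s $ i + of_int z - r" "of_int z"]
    by (auto simp: algebra_simps)
  then show ?thesis by (simp add: alexander_lattice_def of_int_vec_def)
qed

lemma vertex_complexD: "f \<in> vertex_complex X E \<Longrightarrow> f m \<noteq> 0 \<Longrightarrow> m \<in> monomials X E"
  unfolding vertex_complex_def by blast

lemma vertex_complex_zero: "0 \<in> vertex_complex X E"
  and vertex_complex_add: "f \<in> vertex_complex X E \<Longrightarrow> g \<in> vertex_complex X E \<Longrightarrow> f + g \<in> vertex_complex X E"
  by (auto simp: vertex_complex_def) (metis add_0)

lemma total_complex_zero: "0 \<in> total_complex X"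
  and total_complex_add: "f \<in> total_complex X \<Longrightarrow> g \<in> total_complex X \<Longrightarrow> f + g \<in> total_complex X"
  by (auto simp: total_complex_def vertex_complex_zero vertex_complex_add)

lemma total_act_zero: "total_act p 0 = 0"
  and total_act_add: "total_act p (f + g) = total_act p f + total_act p g"
  by (auto simp: total_act_def power_series_act_def fun_eq_iff distrib_left sum.distrib)

lemma equivariant_endo_zero: "equivariant_endo X (\<lambda>f. 0)"
  by (simp add: equivariant_endo_def equivariant_map_def total_complex_zero total_act_zero)

lemma equivariant_endo_add:
  assumes "equivariant_endo X g" "equivariant_endo X h"
  shows "equivariant_endo X (\<lambda>f. g f + h f)"
  using assms by (simp add: equivariant_endo_def equivariant_map_def total_complex_add
      total_act_add ac_simps)

lemma equivariant_endo_sum: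
  assumes "\<And>i. i \<in> A \<Longrightarrow> equivariant_endo X (h i)"
  shows "equivariant_endo X (\<lambda>f. \<Sum>i\<in>A. h i f)"
  using assms
  by (induction A rule: infinite_finite_induct)
    (simp_all add: equivariant_endo_zero equivariant_endo_add)

lemma equivariant_endo_scale:
  assumes "equivariant_endo X h"
  shows "equivariant_endo X (\<lambda>f E m. r * h f E m)"
proof (cases r)
  case zero
  then show ?thesis using equivariant_endo_zero[of X] by (simp add: zero_fun_def)
next
  case one
  then show ?thesis using assms by simp
qed

lemma equivariant_endo_reweight: "equivariant_endo X (reweight X w)"
proof -
  have "reweight X w (total_act p f) E (x, u, v) = total_act p (reweight X w f) E (x, u, v)"
    for p f E x u v
    unfolding reweight_apply total_act_def power_series_act_def
    by (auto simp: sum_distrib_left monomial_grading_times_U intro!: sum.cong)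
  then show ?thesis
    unfolding equivariant_endo_def equivariant_map_def
    by (auto simp: reweight_apply total_complex_def vertex_complex_def fun_eq_iff distrib_left)
qed

lemma is_surgery_complexD:
  assumes "is_surgery_complex K fr X"
  shows "\<And>x. x \<in> points X \<Longrightarrow> alexander X x \<in> alexander_lattice K"
    and "\<And>x y k l. disk_count X x y k l \<noteq> 0 \<Longrightarrow>
      alexander X y - of_nat_vec k + of_nat_vec l = alexander X x"
  using assms by (auto simp: is_surgery_complex_def)

lemma is_surgery_complex_PhiD:
  fixes M :: "'n::finite oriented_sublink"
  assumes "is_surgery_complex K fr X" "M \<in> oriented_sublinks" "E \<inter> components M = {}"
  shows "equivariant_map power_series_act power_series_act
          (vertex_complex X E) (vertex_complex X (E \<union> components M)) (Phi X M E)"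
    and "\<And>s f. s \<in> alexander_lattice K \<Longrightarrow> f \<in> vertex_complex X E \<Longrightarrow>
      graded_part X (s + of_int_vec (orientation_shift (framing_matrix K fr) M)) (Phi X M E f) =
      Phi X M E (graded_part X s f)"
proof -
  have *: "equivariant_map power_series_act power_series_act
          (vertex_complex X E) (vertex_complex X (E \<union> components M)) (Phi X M E) \<and>
        (\<forall>s\<in>alexander_lattice K.
          let s' = s + of_int_vec (orientation_shift (framing_matrix K fr) M) in
            Phi X M E ` graded_piece X E s \<subseteq> graded_piece X (E \<union> components M) s' \<and>
            (\<forall>f\<in>vertex_complex X E.
              graded_part X s' (Phi X M E f) = Phi X M E (graded_part X s f)))"
    using assms unfolding is_surgery_complex_def by blast
  show "equivariant_map power_series_act power_series_act
          (vertex_complex X E) (vertex_complex X (E \<union> components M)) (Phi X M E)"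
    using * by blast
  show "graded_part X (s + of_int_vec (orientation_shift (framing_matrix K fr) M)) (Phi X M E f) =
      Phi X M E (graded_part X s f)"
    if "s \<in> alexander_lattice K" "f \<in> vertex_complex X E" for s f
    using * that by (auto simp: Let_def)
qed

lemma equivariant_endo_total_Phi:
  assumes "is_surgery_complex K fr X" "M \<in> oriented_sublinks"
  shows "equivariant_endo X (total_Phi X M)"
proof -
  have "equivariant_map power_series_act power_series_act
      (vertex_complex X (E - components M)) (vertex_complex X E) (Phi X M (E - components M))"
    if "components M \<subseteq> E" for E
    using is_surgery_complex_PhiD(1)[OF assms, of "E - components M"] that
    by (simp add: Diff_Int_distrib2 Un_absorb2)
  then show ?thesis
    unfolding equivariant_endo_def equivariant_map_def total_complex_def total_Phi_def total_act_def
    using vertex_complex_zero[of X] total_act_zero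
    by (auto simp: fun_eq_iff total_act_def power_series_act_def)
qed

text \<open>A structure map moves the piece of grading \<open>s\<close> into one single grading. If the weight changes by
  the constant \<open>r\<close> along this move, then the commutator of the diagonal operator with the structure
  map is \<open>r\<close> times the structure map. Since chains are infinite products of homogeneous pieces, the
  identity is checked coefficientwise, through the graded part that can contribute.\<close>

lemma total_Phi_reweight:
  fixes M :: "'n::finite oriented_sublink" and X :: "('n, 'x) surgery_data"
  assumes X: "is_surgery_complex K fr X" and M: "M \<in> oriented_sublinks"
    and f: "f \<in> total_complex X"
    and w: "\<And>E s. E \<inter> components M = {} \<Longrightarrow>
      w (E \<union> components M) (s + of_int_vec (orientation_shift (framing_matrix K fr) M)) =
      w E s + r"
  shows "reweight X w (total_Phi X M f) =
    total_Phi X M (reweight X w f) + (\<lambda>E m. r * total_Phi X M f E m)"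
proof (intro ext)
  fix E m
  define \<Lambda> :: "rat ^ 'n" where "\<Lambda> = of_int_vec (orientation_shift (framing_matrix K fr) M)"
  show "reweight X w (total_Phi X M f) E m =
    (total_Phi X M (reweight X w f) + (\<lambda>E m. r * total_Phi X M f E m)) E m"
  proof (cases "components M \<subseteq> E")
    case True
    define E' where "E' = E - components M"
    have E': "E' \<inter> components M = {}" "E' \<union> components M = E"
      using True by (auto simp: E'_def)
    define s where "s = monomial_grading X m - \<Lambda>"
    have s: "monomial_grading X m = s + \<Lambda>" by (simp add: s_def)
    note \<Phi> = is_surgery_complex_PhiD[OF X M E'(1), folded \<Lambda>_def, unfolded E'(2)]
    have g: "f E' \<in> vertex_complex X E'" "reweight X w f E' \<in> vertex_complex X E'"
      using f by (auto simp: total_complex_def vertex_complex_def reweight_apply)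
    have \<Phi>_0: "Phi X M E' 0 = 0"
      using \<Phi>(1) vertex_complex_zero[of X E'] unfolding equivariant_map_def
      by (metis add_cancel_right_right)
    \<comment> \<open>Homogeneity is known only for gradings in the Alexander lattice; a monomial that does not occur
      at the vertex \<open>E\<close> has coefficient 0 on both sides.\<close>
    have "Phi X M E' (reweight X w f E') m = w E' s * Phi X M E' (f E') m"
    proof (cases "m \<in> monomials X E")
      case True
      have lattice: "s \<in> alexander_lattice K"
        using monomial_grading_in_lattice[OF _ True, of K] is_surgery_complexD(1)[OF X]
          alexander_lattice_add_of_int_vec_iff unfolding s \<Lambda>_def by blast
      have "graded_part X s (reweight X w f E') = (if w E' s = 0 then 0 else graded_part X s (f E'))"
        by (auto simp: graded_part_def reweight_apply fun_eq_iff)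
      moreover have "Phi X M E' h m = Phi X M E' (graded_part X s h) m"
        if "h \<in> vertex_complex X E'" for h
        using fun_cong[OF \<Phi>(2)[OF lattice that], of m] by (simp add: graded_part_def s)
      ultimately show ?thesis
        using g \<Phi>_0 by (cases "w E' s") auto
    next
      case False
      then have "Phi X M E' h m = 0" if "h \<in> vertex_complex X E'" for h
        using vertex_complexD[of "Phi X M E' h" X E m] \<Phi>(1) that unfolding equivariant_map_def by blast
      then show ?thesis using g by simp
    qed
    moreover have "w E (s + \<Lambda>) = w E' s + r"
      using w[OF E'(1), of s] by (simp add: E'(2) \<Lambda>_def)
    ultimately show ?thesis
      using True by (simp add: total_Phi_def reweight_apply s distrib_right flip: E'_def)
  next
    case False
    then show ?thesis by (simp add: total_Phi_def reweight_apply)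
  qed
qed

text \<open>The internal differential preserves the Alexander grading, so it commutes with diagonal
  operators.\<close>

lemma internal_diff_reweight:
  assumes "is_surgery_complex K fr X"
  shows "internal_diff X (reweight X w f E) m = w E (monomial_grading X m) * internal_diff X (f E) m"
proof -
  obtain y u v where m: "m = (y, u, v)" by (cases m)
  have "monomial_grading X (x, u - k, v - of_nat_vec l) = monomial_grading X m"
    if "k \<le> u" "disk_count X x y k l \<noteq> 0" for x k l
    using is_surgery_complexD(2)[OF assms that(2), symmetric] that(1)
    by (simp add: m monomial_grading_def of_nat_vec_diff of_int_vec_diff)
  then show ?thesis
    unfolding m internal_diff_def reweight_def
    by (auto simp: sum_distrib_left mult_ac intro!: sum.cong)
qed

text \<open>In characteristic 2 the internal parts cancel, and each structure map contributes its increment.\<close>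

lemma surgery_diff_reweight_commutator:
  fixes X :: "('n::finite, 'x) surgery_data"
  assumes X: "is_surgery_complex K fr X" and f: "f \<in> total_complex X"
    and w: "\<And>M E s. M \<in> oriented_sublinks \<Longrightarrow> E \<inter> components M = {} \<Longrightarrow>
      w (E \<union> components M) (s + of_int_vec (orientation_shift (framing_matrix K fr) M)) =
      w E s + r M"
  shows "surgery_diff X (reweight X w f) + reweight X w (surgery_diff X f) =
    (\<Sum>M\<in>oriented_sublinks. (\<lambda>E m. r M * total_Phi X M f E m))"
proof (intro ext)
  fix E m
  have "w E (monomial_grading X m) * total_Phi X M f E m =
      total_Phi X M (reweight X w f) E m + r M * total_Phi X M f E m"
    if "M \<in> oriented_sublinks" for M
    using fun_cong[OF fun_cong[OF total_Phi_reweight[where w = w and r = "r M", OF X that f w[OF that]]], of E m]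
    by (simp add: reweight_apply)
  then have "(\<Sum>M\<in>oriented_sublinks. w E (monomial_grading X m) * total_Phi X M f E m) =
     (\<Sum>M\<in>oriented_sublinks. total_Phi X M (reweight X w f) E m) +
     (\<Sum>M\<in>oriented_sublinks. r M * total_Phi X M f E m)"
    by (simp add: sum.distrib)
  then show "(surgery_diff X (reweight X w f) + reweight X w (surgery_diff X f)) E m =
    (\<Sum>M\<in>oriented_sublinks. (\<lambda>E m. r M * total_Phi X M f E m)) E m"
    by (simp add: surgery_diff_def sum_fun_apply reweight_apply internal_diff_reweight[OF X]
        distrib_left sum_distrib_left ac_simps)
qed

section \<open>The homology action\<close>

text \<open>Collecting the terms by oriented sublink instead of by knot: the coefficient of \<open>\<Phi>\<close> for \<open>M\<close> is
  the sum of the coefficients of the components that \<open>M\<close> orients positively.\<close>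

lemma homology_action_eq_sum:
  "homology_action X a f =
    (\<Sum>M\<in>oriented_sublinks. (\<lambda>E m. of_int (\<Sum>i\<in>fst M. a i) * total_Phi X M f E m))"
proof (intro ext)
  fix E m
  have "homology_action X a f E m = (\<Sum>i\<in>UNIV. \<Sum>M | M \<in> oriented_sublinks \<and> i \<in> fst M.
      of_int (a i) * total_Phi X M f E m)"
    by (simp add: homology_action_def knot_map_def sum_fun_apply sum_distrib_left)
  also have "\<dots> = (\<Sum>M\<in>oriented_sublinks. \<Sum>i | i \<in> UNIV \<and> i \<in> fst M.
      of_int (a i) * total_Phi X M f E m)"
    by (rule sum.swap_restrict) auto
  finally show "homology_action X a f E m =
    (\<Sum>M\<in>oriented_sublinks. (\<lambda>E m. of_int (\<Sum>i\<in>fst M. a i) * total_Phi X M f E m)) E m"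
    by (simp add: sum_fun_apply sum_distrib_right)
qed

lemma equivariant_endo_homology_action:
  assumes "is_surgery_complex K fr X"
  shows "equivariant_endo X (homology_action X a)"
  unfolding homology_action_eq_sum[abs_def]
  by (intro equivariant_endo_sum equivariant_endo_scale equivariant_endo_total_Phi[OF assms])

text \<open>This is where the symmetry of the framing matrix enters: if \<open>n d = \<Lambda> c\<close>, the rational functional
  \<open>s \<mapsto> (c \<cdot> s) / n\<close> takes the integer value \<open>d\<^sub>j\<close> on the \<open>j\<close>-th framed longitude.\<close>

lemma orientation_shift_pairing:
  fixes Lam :: "int ^ 'n::finite ^ 'n"
  assumes "transpose Lam = Lam" "n > 0" "\<And>i. int n * d i = (Lam *v c) $ i"
  shows "(\<Sum>i\<in>UNIV. of_int (c $ i) * of_int_vec (orientation_shift Lam M) $ i) / of_nat n =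
    (of_int (\<Sum>j\<in>snd M. d j) :: rat)"
proof -
  have "(\<Sum>i\<in>UNIV. c $ i * orientation_shift Lam M $ i) = (\<Sum>j\<in>snd M. \<Sum>i\<in>UNIV. c $ i * Lam $ i $ j)"
    unfolding orientation_shift_def
    by (simp add: sum_distrib_left column_def sum.swap[of _ UNIV])
  also have "\<dots> = (\<Sum>j\<in>snd M. (transpose Lam *v c) $ j)"
    by (simp add: matrix_vector_mult_def transpose_def mult.commute)
  also have "\<dots> = int n * (\<Sum>j\<in>snd M. d j)"
    by (simp add: assms sum_distrib_left)
  finally have "of_int (\<Sum>i\<in>UNIV. c $ i * orientation_shift Lam M $ i) =
      (of_nat n * of_int (\<Sum>j\<in>snd M. d j) :: rat)"
    by (metis of_int_mult of_int_of_nat_eq)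
  then show ?thesis
    using assms(2) by (simp add: of_int_vec_def)
qed

theorem lemma4p1:
  fixes K :: "'n::finite \<Rightarrow> real \<Rightarrow> real ^ 4"
    and fr :: "'n \<Rightarrow> int"
    and X :: "('n, 'x) surgery_data"
    and a b :: "'n \<Rightarrow> int"
  assumes "is_link K"
    and "is_surgery_complex K fr X"
    and "\<gamma> \<in> carrier (surgery_H1_mod_tors (framing_matrix K fr))"
    and "\<gamma> = meridian_combination (framing_matrix K fr) a"
    and "\<gamma> = meridian_combination (framing_matrix K fr) b"
  shows "equivariantly_homotopic X (homology_action X a) (homology_action X b)"
proof -
  let ?\<Lambda> = "framing_matrix K fr"
  define d where "d = (\<lambda>i. a i - b i)"
  obtain n c where n: "n > 0" and c: "\<And>i. int n * d i = (?\<Lambda> *v c) $ i"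
    using meridian_combination_eqD[of ?\<Lambda> a b] assms(4,5) unfolding d_def by metis
  define q :: "rat ^ 'n \<Rightarrow> rat" where "q s = (\<Sum>i\<in>UNIV. of_int (c $ i) * s $ i) / of_nat n" for s
  \<comment> \<open>The value of \<open>q\<close> at an Alexander grading need not be an integer. Rounding down gives one, and it
    is compatible with the integral increments of \<open>q\<close> along the framed longitudes.\<close>
  define w :: "'n set \<Rightarrow> rat ^ 'n \<Rightarrow> bit" where "w E s = of_int (\<lfloor>q s\<rfloor> + (\<Sum>j\<in>E. d j))" for E s
  have q_add: "q (s + t) = q s + q t" for s t
    by (simp add: q_def distrib_left sum.distrib add_divide_distrib)
  have q_shift: "q (of_int_vec (orientation_shift ?\<Lambda> M)) = of_int (\<Sum>j\<in>snd M. d j)" for M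
    unfolding q_def by (rule orientation_shift_pairing[OF framing_matrix_symmetric[OF assms(1)] n c])
  have w: "w (E \<union> components M) (s + of_int_vec (orientation_shift ?\<Lambda> M)) =
      w E s + of_int (\<Sum>j\<in>fst M. d j)"
    if M: "M \<in> oriented_sublinks" and E: "E \<inter> components M = {}" for M E s
  proof -
    have "(\<Sum>j\<in>E \<union> components M. d j) = (\<Sum>j\<in>E. d j) + (\<Sum>j\<in>components M. d j)"
      using E by (intro sum.union_disjoint) auto
    also have "(\<Sum>j\<in>components M. d j) = (\<Sum>j\<in>fst M. d j) + (\<Sum>j\<in>snd M. d j)"
      using M unfolding components_def by (intro sum.union_disjoint) (auto simp: oriented_sublinks_def)
    \<comment> \<open>The negative components are counted by both summands of the weight, so they cancel modulo 2.\<close>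
    finally have "\<lfloor>q (s + of_int_vec (orientation_shift ?\<Lambda> M))\<rfloor> + (\<Sum>j\<in>E \<union> components M. d j) =
        (\<lfloor>q s\<rfloor> + (\<Sum>j\<in>E. d j)) + (\<Sum>j\<in>fst M. d j) + ((\<Sum>j\<in>snd M. d j) + (\<Sum>j\<in>snd M. d j))"
      by (simp only: q_add q_shift floor_add_int[symmetric])
    then show ?thesis
      unfolding w_def by (simp only: of_int_add bit_add_self add_0_right)
  qed
  have "homology_action X a f - homology_action X b f =
      surgery_diff X (reweight X w f) + reweight X w (surgery_diff X f)"
    if "f \<in> total_complex X" for f
  proof -
    have "homology_action X a f - homology_action X b f = homology_action X d f"
      by (simp add: homology_action_def d_def fun_eq_iff sum_fun_apply left_diff_distrib sum_subtractf
          del: minus_bit_def)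
    also have "\<dots> = surgery_diff X (reweight X w f) + reweight X w (surgery_diff X f)"
      unfolding homology_action_eq_sum
      by (rule surgery_diff_reweight_commutator[OF assms(2) that w, symmetric])
    finally show ?thesis .
  qed
  then show ?thesis
    unfolding equivariantly_homotopic_def
    using equivariant_endo_homology_action[OF assms(2)] equivariant_endo_reweight by blast
qed

end
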